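(* Let $q$ be a nonzero complex number with $|q|<1$. Let $a,b,c$ be positive integers and put $D:=b^2-ac$; assume $D<0$. Then for generic $x,y\in\mathbb{C}\setminus\{0\}$ (that is, for all nonzero $x,y$ for which both sides are defined; no denominators other than powers of $q$, $x$, $y$ occur), \begin{align*} f_{a,b,c}(x,y;q) &=\frac{1}{2}\Bigg(\sum_{t=0}^{a-1}(-y)^t q^{c\binom{t}{2}}\,\Theta(q^{bt}x;q^a)\sum_{r\in\mathbb{Z}}\operatorname{sg}(r)\left(q^{a\binom{b+1}{2}-c\binom{a+1}{2}-tD}\,\frac{(-y)^a}{(-x)^b}\right)^{r} q^{-aD\binom{r+1}{2}}\\ &\qquad+\sum_{t=0}^{c-1}(-x)^t q^{a\binom{t}{2}}\,\Theta(q^{bt}y;q^c)\sum_{r\in\mathbb{Z}}\operatorname{sg}(r)\left(q^{c\binom{b+1}{2}-a\binom{c+1}{2}-tD}\,\frac{(-x)^c}{(-y)^b}\right)^{r} q^{-cD\binom{r+1}{2}}\Bigg). \end{align*}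
   Context: For an integer $n$ (possibly negative), $\binom{n}{2}:=n(n-1)/2$. The sign function on integers is $\operatorname{sg}(r):=1$ for $r\ge 0$ and $\operatorname{sg}(r):=-1$ for $r<0$. For integers $r,s$ put $\operatorname{sg}(r,s):=\frac{\operatorname{sg}(r)+\operatorname{sg}(s)}{2}$. For $x,y\in\mathbb{C}\setminus\{0\}$, the Hecke-type double-sum is $$f_{a,b,c}(x,y;q):=\sum_{r,s\in\mathbb{Z}}\operatorname{sg}(r,s)(-1)^{r+s}x^ry^sq^{a\binom{r}{2}+brs+c\binom{s}{2}}=\Big(\sum_{r,s\ge 0}-\sum_{r,s<0}\Big)(-1)^{r+s}x^ry^sq^{a\binom{r}{2}+brs+c\binom{s}{2}}.$$ For nonzero complex $q$ with $|q|<1$ and $x\in\mathbb{C}\setminus\{0\}$, let $(x;q)_\infty:=\prod_{i\ge 0}(1-q^ix)$ and define the theta function $$\Theta(x;q):=(x;q)_\infty(q/x;q)_\infty(q;q)_\infty=\sum_{n=-\infty}^{\infty}(-1)^nq^{\binom{n}{2}}x^n,$$ where the last equality is the Jacobi triple product identity. $\Theta(x;q^a)$ denotes the same function with $q$ replaced by $q^a$. *)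

theory Defs
  imports "HOL-Analysis.Analysis"
begin

definition binom2 :: "int \<Rightarrow> int" where
  "binom2 n = n * (n - 1) div 2"

text \<open>Unlike \<^const>\<open>sgn\<close>, this sign function takes the value 1 at 0.\<close>
definition sg :: "int \<Rightarrow> int" where
  "sg r = (if r \<ge> 0 then 1 else -1)"

definition sg2 :: "int \<Rightarrow> int \<Rightarrow> complex" where
  "sg2 r s = (of_int (sg r) + of_int (sg s)) / 2"

text \<open>For positive \<open>a\<close>, \<open>b\<close>, \<open>c\<close>, nonzero \<open>x\<close>, \<open>y\<close> and \<open>0 < |q| < 1\<close> the double series
  converges absolutely: \<open>sg2\<close> vanishes unless \<open>r, s \<ge> 0\<close> or \<open>r, s < 0\<close>, and in
  both cases \<open>b r s \<ge> 0\<close>. Hence the unordered sum below is the usual value of the series.\<close>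
definition hecke_f :: "int \<Rightarrow> int \<Rightarrow> int \<Rightarrow> complex \<Rightarrow> complex \<Rightarrow> complex \<Rightarrow> complex" where
  "hecke_f a b c x y q =
     (\<Sum>\<^sub>\<infinity>(r, s)\<in>UNIV. sg2 r s * (-1) powi (r + s) * x powi r * y powi s
        * q powi (a * binom2 r + b * r * s + c * binom2 s))"

text \<open>The value of the infinite product is 0, as it should be, when some factor vanishes.\<close>
definition qpoch_inf :: "complex \<Rightarrow> complex \<Rightarrow> complex" where
  "qpoch_inf x q = (\<Prod>i. 1 - q ^ i * x)"

definition Theta :: "complex \<Rightarrow> complex \<Rightarrow> complex" where
  "Theta x q = qpoch_inf x q * qpoch_inf (q / x) q * qpoch_inf q q"

end

theory Submission imports Defs begin

text \<open>
  Since \<open>sg2 r s = (sg r + sg s) / 2\<close>, the double sum is half the sum of two double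
  series over all of \<open>\<int>\<^sup>2\<close>, one weighted by \<open>sg s\<close> and the other by \<open>sg r\<close>. The two can be
  separated because \<open>D < 0\<close> makes the quadratic form \<open>a r\<^sup>2 + 2 b r s + c s\<^sup>2\<close> positive definite,
  so that each series converges absolutely on its own
  (\<open>abs_summable_on_double_theta_terms\<close>). Exchanging \<open>(a, x, r)\<close> with \<open>(c, y, s)\<close> turns one
  series into the other, so only the one weighted by \<open>sg s\<close> has to be evaluated.

  In that series substitute \<open>r = n - b k\<close> and \<open>s = t + a k\<close> with \<open>0 \<le> t < a\<close>. This is a bijection
  between triples \<open>(t, k, n)\<close> and pairs \<open>(r, s)\<close>. The vector \<open>(- b, a)\<close> is
  orthogonal to \<open>(1, 0)\<close> for the quadratic form, so the exponent of \<open>q\<close> has no mixed term in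
  \<open>n k\<close>; and \<open>sg (t + a k) = sg k\<close>. For fixed \<open>t\<close> the summand is therefore a product of a function
  of \<open>k\<close> and a function of \<open>n\<close>. The sum over \<open>n\<close> is a theta function by the Jacobi triple
  product; the sum over \<open>k\<close> is the theta series with signs \<open>sg k\<close> of the claim.

  The triple product is obtained from its finite form
  \[ \prod_{i<n} (1 - q^i x)(1 - q^{i+1}/x)
     = \sum_k (-x)^k q^{k(k-1)/2} \frac{(q;q)_{2n}}{(q;q)_{n+k} (q;q)_{n-k}} \]
  by letting \<open>n\<close> tend to infinity; dominated convergence applies since the quotients
  are bounded uniformly in \<open>n\<close> and \<open>k\<close>.
\<close>

section \<open>Summability of Gaussian terms\<close>

lemma double_binom2: "2 * binom2 n = n * (n - 1)"
  unfolding binom2_def by (cases "even n") auto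

lemma real_of_int_binom2: "real_of_int (binom2 n) = real_of_int n * (real_of_int n - 1) / 2"
proof -
  have "2 * real_of_int (binom2 n) = real_of_int (2 * binom2 n)" by simp
  also have "\<dots> = real_of_int n * (real_of_int n - 1)" by (simp only: double_binom2) simp
  finally show ?thesis by simp
qed

text \<open>Estimates are carried out on exponents, where they become inequalities between real
  quadratic polynomials.\<close>

lemma norm_power_int_eq_exp:
  fixes x :: complex
  assumes "x \<noteq> 0"
  shows "norm (x powi k) = exp (real_of_int k * ln (norm x))"
proof -
  have "norm (x powi k) = norm x powi k" by (simp add: norm_power_int)
  also have "\<dots> = norm x powr real_of_int k" using assms by (simp add: powr_real_of_int')
  finally show ?thesis using assms by (simp add: powr_def)
qed

lemma summable_on_exp_neg_abs: "(\<lambda>k::int. exp (- \<bar>real_of_int k\<bar>)) summable_on UNIV"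
proof -
  have geo: "summable (\<lambda>n. exp (- 1 :: real) ^ n)" by (rule summable_geometric) simp
  have e: "exp (- 1 :: real) ^ n = exp (- real n)" for n
    by (simp flip: exp_of_nat_mult)
  have nat: "(\<lambda>n::nat. exp (- real n)) summable_on UNIV"
    using geo unfolding e by (intro norm_summable_imp_summable_on) simp
  have pos: "(\<lambda>k::int. exp (- \<bar>real_of_int k\<bar>)) summable_on {0..}"
    using nat by (subst summable_on_reindex_bij_witness[of _ int nat UNIV "\<lambda>n. exp (- real n)"]) auto
  have neg: "(\<lambda>k::int. exp (- \<bar>real_of_int k\<bar>)) summable_on {..0}"
    using nat by (subst summable_on_reindex_bij_witness[of _ "\<lambda>n. - int n" "\<lambda>k. nat (- k)" UNIV
        "\<lambda>n. exp (- real n)"]) auto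
  have "(\<lambda>k::int. exp (- \<bar>real_of_int k\<bar>)) summable_on ({0..} \<union> ({..0} - {0..}))"
    by (intro summable_on_Un_disjoint pos summable_on_subset_banach[OF neg]) auto
  moreover have "({0..} \<union> ({..0} - {0..})) = (UNIV :: int set)" by auto
  ultimately show ?thesis by simp
qed

text \<open>By completing the square, a negative definite quadratic exponent lies below
  \<open>const - |k|\<close>, which leaves a two-sided geometric series.\<close>

lemma summable_on_gaussian:
  assumes "\<alpha> > 0"
  shows "(\<lambda>k::int. exp (\<beta> * real_of_int k - \<alpha> * (real_of_int k)\<^sup>2)) summable_on UNIV"
proof -
  define m where "m = \<bar>\<beta>\<bar> + 1"
  have bound: "\<beta> * t - \<alpha> * t\<^sup>2 \<le> m\<^sup>2 / (4 * \<alpha>) + (- \<bar>t\<bar>)" for t :: real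
  proof -
    have "0 \<le> (2 * \<alpha> * \<bar>t\<bar> - m)\<^sup>2 / (4 * \<alpha>)" using assms by simp
    also have "\<dots> = \<alpha> * t\<^sup>2 - m * \<bar>t\<bar> + m\<^sup>2 / (4 * \<alpha>)"
      using assms by (simp add: power2_eq_square field_simps)
    finally have "m * \<bar>t\<bar> - \<alpha> * t\<^sup>2 \<le> m\<^sup>2 / (4 * \<alpha>)" by simp
    moreover have "\<beta> * t \<le> \<bar>\<beta>\<bar> * \<bar>t\<bar>" by (metis abs_ge_self abs_mult)
    ultimately show ?thesis by (simp add: m_def algebra_simps)
  qed
  show ?thesis
  proof (rule summable_on_comparison_test)
    show "(\<lambda>k::int. exp (m\<^sup>2 / (4 * \<alpha>)) * exp (- \<bar>real_of_int k\<bar>)) summable_on UNIV"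
      by (rule summable_on_cmult_right[OF summable_on_exp_neg_abs])
    fix k :: int
    show "exp (\<beta> * real_of_int k - \<alpha> * (real_of_int k)\<^sup>2)
        \<le> exp (m\<^sup>2 / (4 * \<alpha>)) * exp (- \<bar>real_of_int k\<bar>)"
      using bound[of "real_of_int k"] by (simp flip: exp_add)
  qed simp
qed

lemma abs_summable_on_theta_terms:
  fixes q x :: complex
  assumes "q \<noteq> 0" "norm q < 1" "x \<noteq> 0"
  shows "(\<lambda>k. norm (x powi k * q powi binom2 k)) summable_on UNIV"
proof -
  define l where "l = - ln (norm q)"
  have l: "l > 0" using assms by (simp add: l_def)
  have "norm (x powi k * q powi binom2 k)
      = exp ((ln (norm x) + l / 2) * real_of_int k - l / 2 * (real_of_int k)\<^sup>2)" for k
    using assms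
    by (simp add: norm_mult norm_power_int_eq_exp real_of_int_binom2 l_def field_simps
        power2_eq_square flip: exp_add)
  then show ?thesis using summable_on_gaussian[of "l / 2"] l by simp
qed

text \<open>The smaller eigenvalue of a positive definite \<open>2 \<times> 2\<close> matrix \<open>M\<close> is at least
  \<open>det M / tr M\<close>: by Cayley-Hamilton, \<open>tr M \<cdot> M - det M \<cdot> I = M\<^sup>2\<close>, and
  \<open>v \<bullet> M\<^sup>2 v = |M v|\<^sup>2 \<ge> 0\<close>. The bound \<open>det M \<ge> 1\<close> is automatic for integer entries.\<close>

lemma pos_def_binary_form_lower_bound:
  fixes a b c r s :: real
  assumes "a > 0" "c > 0" "a * c - b\<^sup>2 \<ge> 1"
  shows "a * r\<^sup>2 + 2 * b * r * s + c * s\<^sup>2 \<ge> (r\<^sup>2 + s\<^sup>2) / (a + c)"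
proof -
  have "r\<^sup>2 + s\<^sup>2 \<le> (a * c - b\<^sup>2) * (r\<^sup>2 + s\<^sup>2)"
    using mult_right_mono[OF assms(3), of "r\<^sup>2 + s\<^sup>2"] by simp
  also have "\<dots> \<le> (a * c - b\<^sup>2) * (r\<^sup>2 + s\<^sup>2) + ((a * r + b * s)\<^sup>2 + (b * r + c * s)\<^sup>2)"
    by simp
  also have "\<dots> = (a + c) * (a * r\<^sup>2 + 2 * b * r * s + c * s\<^sup>2)"
    by algebra
  finally show ?thesis using assms by (simp add: field_simps)
qed

text \<open>Positive definiteness splits the exponent: it dominates a sum of a quadratic
  polynomial in \<open>r\<close> and one in \<open>s\<close>, so the series is dominated by a product of two Gaussian
  series.\<close>

lemma abs_summable_on_double_theta_terms:
  fixes q x y :: complex and a b c :: int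
  assumes "q \<noteq> 0" "norm q < 1" "x \<noteq> 0" "y \<noteq> 0" "a > 0" "c > 0" "b\<^sup>2 < a * c"
  shows "(\<lambda>(r, s). norm (x powi r * y powi s * q powi (a * binom2 r + b * r * s + c * binom2 s)))
           summable_on UNIV"
proof -
  define l where "l = - ln (norm q)"
  have l: "l > 0" using assms by (simp add: l_def)
  define \<epsilon> where "\<epsilon> = l / (2 * (real_of_int a + real_of_int c))"
  have \<epsilon>: "\<epsilon> > 0" using l assms by (simp add: \<epsilon>_def)
  define g where "g = (\<lambda>r::int. exp ((ln (norm x) + l * a / 2) * real_of_int r - \<epsilon> * (real_of_int r)\<^sup>2))"
  define h where "h = (\<lambda>s::int. exp ((ln (norm y) + l * c / 2) * real_of_int s - \<epsilon> * (real_of_int s)\<^sup>2))"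
  have g: "g summable_on UNIV" and h: "h summable_on UNIV"
    unfolding g_def h_def by (rule summable_on_gaussian[OF \<epsilon>])+
  have gh: "(\<lambda>(r, s). g r * h s) summable_on UNIV \<times> UNIV"
  proof (rule summable_on_SigmaI)
    show "((\<lambda>s. case (r, s) of (r, s) \<Rightarrow> g r * h s) has_sum g r * infsum h UNIV) UNIV" for r
      using has_sum_cmult_right[OF has_sum_infsum[OF h]] by simp
    show "(\<lambda>r. g r * infsum h UNIV) summable_on UNIV"
      by (rule summable_on_cmult_left[OF g])
  qed (simp add: g_def h_def)
  (* the determinant of an integer form that is positive is at least 1 *)
  have "real_of_int (b\<^sup>2 + 1) \<le> real_of_int (a * c)"
    using assms(7) by linarith
  then have disc: "real_of_int a * real_of_int c - (real_of_int b)\<^sup>2 \<ge> 1" by simp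
  have term_bound:
    "norm (x powi r * y powi s * q powi (a * binom2 r + b * r * s + c * binom2 s)) \<le> g r * h s"
    for r s
  proof -
    define R S where "R = real_of_int r" and "S = real_of_int s"
    have "(R\<^sup>2 + S\<^sup>2) / (a + c) \<le> a * R\<^sup>2 + 2 * b * R * S + c * S\<^sup>2"
      using pos_def_binary_form_lower_bound[OF _ _ disc, of R S] assms by simp
    from mult_left_mono[OF this, of "l / 2"] l
    have "\<epsilon> * (R\<^sup>2 + S\<^sup>2) \<le> l / 2 * (a * R\<^sup>2 + 2 * b * R * S + c * S\<^sup>2)"
      by (simp add: \<epsilon>_def)
    moreover have "((ln (norm x) + l * a / 2) * R - \<epsilon> * R\<^sup>2)
          + ((ln (norm y) + l * c / 2) * S - \<epsilon> * S\<^sup>2)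
        - (R * ln (norm x) + S * ln (norm y)
          + (a * (R * (R - 1) / 2) + b * R * S + c * (S * (S - 1) / 2)) * (- l))
        = l / 2 * (a * R\<^sup>2 + 2 * b * R * S + c * S\<^sup>2) - \<epsilon> * (R\<^sup>2 + S\<^sup>2)"
      by (simp add: field_simps power2_eq_square)
    ultimately have "R * ln (norm x) + S * ln (norm y)
          + (a * (R * (R - 1) / 2) + b * R * S + c * (S * (S - 1) / 2)) * (- l)
        \<le> ((ln (norm x) + l * a / 2) * R - \<epsilon> * R\<^sup>2) + ((ln (norm y) + l * c / 2) * S - \<epsilon> * S\<^sup>2)"
      by linarith
    moreover have "norm (x powi r * y powi s * q powi (a * binom2 r + b * r * s + c * binom2 s))
        = exp (R * ln (norm x) + S * ln (norm y)
          + (a * (R * (R - 1) / 2) + b * R * S + c * (S * (S - 1) / 2)) * (- l))"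
      using assms(1,3,4)
      by (simp only: norm_mult norm_power_int_eq_exp exp_add l_def R_def S_def of_int_add of_int_mult
          real_of_int_binom2 minus_minus not_False_eq_True)
    moreover have "g r * h s = exp (((ln (norm x) + l * a / 2) * R - \<epsilon> * R\<^sup>2)
        + ((ln (norm y) + l * c / 2) * S - \<epsilon> * S\<^sup>2))"
      by (simp only: g_def h_def exp_add R_def S_def)
    ultimately show ?thesis by simp
  qed
  show ?thesis
  proof (rule summable_on_comparison_test)
    show "(\<lambda>(r, s). g r * h s) summable_on UNIV" using gh by simp
    fix p :: "int \<times> int"
    show "(case p of (r, s) \<Rightarrow> norm (x powi r * y powi s * q powi (a * binom2 r + b * r * s + c * binom2 s)))
        \<le> (case p of (r, s) \<Rightarrow> g r * h s)"
      using term_bound by (cases p) (simp only: prod.case)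
    show "0 \<le> (case p of (r, s) \<Rightarrow> norm (x powi r * y powi s * q powi (a * binom2 r + b * r * s + c * binom2 s)))"
      by (cases p) (simp only: prod.case norm_ge_zero)
  qed
qed

section \<open>The Jacobi triple product\<close>

text \<open>Tannery's theorem for series over the integers, transported along an enumeration
  of \<open>\<int>\<close>.\<close>

lemma tendsto_dominated_has_sum:
  fixes f :: "nat \<Rightarrow> int \<Rightarrow> complex"
  assumes sums: "\<And>n. (f n has_sum S n) UNIV"
    and lim: "\<And>k. (\<lambda>n. f n k) \<longlonglongrightarrow> g k"
    and bound: "\<And>n k. norm (f n k) \<le> M k"
    and M: "M summable_on UNIV"
  shows "S \<longlonglongrightarrow> infsum g UNIV"
proof -
  have reindex: "((\<lambda>j. h (int_decode j)) has_sum s) UNIV \<longleftrightarrow> (h has_sum s) UNIV"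
    for h :: "int \<Rightarrow> complex" and s
    by (rule has_sum_reindex_bij_betw[OF bij_int_decode])
  have M': "summable (\<lambda>j. M (int_decode j))"
    using M summable_on_reindex_bij_betw[OF bij_int_decode, of M]
    by (auto intro: summable_on_imp_summable)
  have bound': "\<forall>\<^sub>F (j, n) in sequentially \<times>\<^sub>F sequentially.
      norm (f n (int_decode j)) \<le> M (int_decode j)"
    using bound by (intro always_eventually) auto
  have T: "summable (\<lambda>j. norm (g (int_decode j)))"
          "(\<lambda>n. \<Sum>j. f n (int_decode j)) \<longlonglongrightarrow> (\<Sum>j. g (int_decode j))"
    using tannerys_theorem[OF lim bound' M' sequentially_bot] by auto
  have "(\<Sum>j. f n (int_decode j)) = S n" for n
    using sums reindex by (metis has_sum_imp_sums sums_unique)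
  moreover have "(\<Sum>j. g (int_decode j)) = infsum g UNIV"
    using norm_summable_imp_has_sum[OF T(1) summable_sums[OF summable_norm_cancel[OF T(1)]]]
    by (simp add: reindex infsumI)
  ultimately show ?thesis using T(2) by simp
qed

text \<open>The reciprocal of \<open>(q;q)\<^sub>n\<close>. The value 0 at negative \<open>n\<close> makes the recursion
  \<open>qfact_inv_step\<close> hold at every integer, including \<open>n = 0\<close>, and truncates the
  finite triple product to \<open>|k| \<le> n\<close> without an explicit range of summation.\<close>

definition qfact_inv :: "complex \<Rightarrow> int \<Rightarrow> complex" where
  "qfact_inv q n = (if n < 0 then 0 else inverse (\<Prod>i<nat n. 1 - q ^ i * q))"

lemma norm_power_Suc_less_one:
  fixes q :: "'a :: real_normed_div_algebra"
  assumes "norm q < 1"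
  shows "norm (q ^ Suc n) < 1"
proof -
  have "norm q * norm q ^ n \<le> norm q * 1"
    using assms by (intro mult_left_mono power_le_one) auto
  then show ?thesis using assms by (simp add: norm_mult norm_power)
qed

lemma one_minus_power_nonzero:
  fixes q :: complex
  assumes "norm q < 1"
  shows "1 - q ^ i * q \<noteq> 0"
proof
  assume "1 - q ^ i * q = 0"
  then have "q ^ Suc i = 1" by (simp add: mult.commute)
  then show False using norm_power_Suc_less_one[OF assms, of i] by simp
qed

lemma qfact_inv_step:
  assumes "norm q < 1"
  shows "qfact_inv q (n - 1) = (1 - q powi n) * qfact_inv q n"
proof (cases "n > 0")
  case True
  then obtain m where m: "n = int (Suc m)" by (metis zero_less_imp_eq_int Suc_pred)
  have "q powi n = q ^ m * q" unfolding m by (simp only: power_int_of_nat) simp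
  moreover have "qfact_inv q (n - 1) = inverse (\<Prod>i<m. 1 - q ^ i * q)"
    by (simp add: m qfact_inv_def)
  moreover have "qfact_inv q n = inverse ((\<Prod>i<m. 1 - q ^ i * q) * (1 - q ^ m * q))"
    by (simp only: m qfact_inv_def nat_int prod.lessThan_Suc) simp
  ultimately show ?thesis using one_minus_power_nonzero[OF assms, of m] by simp
next
  case False
  then show ?thesis by (cases "n = 0") (auto simp: qfact_inv_def)
qed

text \<open>Passing from \<open>n\<close> to \<open>n + 1\<close> multiplies the product by
  \<open>(1 - q\<^sup>n x) (1 - q\<^sup>n\<^sup>+\<^sup>1 / x) = 1 + q\<^sup>2\<^sup>n\<^sup>+\<^sup>1 - q\<^sup>n x - q\<^sup>n\<^sup>+\<^sup>1 / x\<close>, that is, it combines the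
  coefficient sequence with its two shifts by one. All coefficients that occur are polynomial
  multiples of \<open>A B\<close>, where \<open>A\<close> and \<open>B\<close> are the reciprocals of \<open>(q;q)\<^sub>n\<^sub>+\<^sub>k\<^sub>+\<^sub>1\<close> and
  \<open>(q;q)\<^sub>n\<^sub>-\<^sub>k\<^sub>+\<^sub>1\<close>, and the claim becomes a polynomial identity in \<open>q\<close>, \<open>v = q\<^sup>n\<^sup>+\<^sup>k\<close> and
  \<open>w = q\<^sup>n\<^sup>-\<^sup>k\<close>.\<close>

lemma finite_triple_product:
  fixes q x :: complex
  assumes "q \<noteq> 0" "norm q < 1" "x \<noteq> 0"
  shows "((\<lambda>k. (- x) powi k * q powi binom2 k * ((\<Prod>i<2 * n. 1 - q ^ i * q)
             * qfact_inv q (int n + k) * qfact_inv q (int n - k)))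
           has_sum (\<Prod>i<n. 1 - q ^ i * x) * (\<Prod>i<n. 1 - q ^ i * (q / x))) UNIV"
proof (induction n)
  case 0
  have "((\<lambda>k. (- x) powi k * q powi binom2 k * (qfact_inv q k * qfact_inv q (- k)))
           has_sum (\<Sum>k\<in>{0}. (- x) powi k * q powi binom2 k * (qfact_inv q k * qfact_inv q (- k)))) UNIV"
    by (rule has_sum_finite_neutralI[of "{0}"]) (auto simp: qfact_inv_def)
  then show ?case by (simp add: qfact_inv_def binom2_def)
next
  case (Suc n)
  define u where "u = (\<lambda>k. (- x) powi k * q powi binom2 k)"
  define Q where "Q = (\<Prod>i<2 * n. 1 - q ^ i * q)"
  define R where "R = qfact_inv q"
  define c where "c = (\<lambda>k. u k * (Q * R (int n + k) * R (int n - k)))"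
  define P where "P = (\<Prod>i<n. 1 - q ^ i * x) * (\<Prod>i<n. 1 - q ^ i * (q / x))"
  have c: "(c has_sum P) UNIV" using Suc.IH by (simp add: c_def u_def Q_def R_def P_def)
  have c1: "((\<lambda>k. c (k - 1)) has_sum P) UNIV"
    using c by (subst has_sum_reindex_bij_witness[of _ "\<lambda>k. k + 1" "\<lambda>k. k - 1" UNIV c]) auto
  have c2: "((\<lambda>k. c (k + 1)) has_sum P) UNIV"
    using c by (subst has_sum_reindex_bij_witness[of _ "\<lambda>k. k - 1" "\<lambda>k. k + 1" UNIV c]) auto
  have "((\<lambda>k. (1 + q ^ n * (q ^ n * q)) * c k + (- (q ^ n * x)) * c (k - 1)
             + (- (q ^ n * q / x)) * c (k + 1))
          has_sum (1 + q ^ n * (q ^ n * q)) * P + (- (q ^ n * x)) * P + (- (q ^ n * q / x)) * P) UNIV"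
    by (intro has_sum_add has_sum_cmult_right c c1 c2)
  moreover have "(1 + q ^ n * (q ^ n * q)) * P + (- (q ^ n * x)) * P + (- (q ^ n * q / x)) * P
      = (\<Prod>i<Suc n. 1 - q ^ i * x) * (\<Prod>i<Suc n. 1 - q ^ i * (q / x))"
    using assms by (simp add: P_def field_simps)
  moreover have "(1 + q ^ n * (q ^ n * q)) * c k + (- (q ^ n * x)) * c (k - 1)
             + (- (q ^ n * q / x)) * c (k + 1)
      = u k * ((\<Prod>i<2 * Suc n. 1 - q ^ i * q) * R (int (Suc n) + k) * R (int (Suc n) - k))" for k
  proof -
    define v w where "v = q powi (int n + k)" and "w = q powi (int n - k)"
    define A B where "A = R (int n + k + 1)" and "B = R (int n - k + 1)"
    have vw: "v * w = q ^ n * q ^ n"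
    proof -
      have "q powi k * q powi (- k) = 1" for k using assms by (simp add: power_int_minus)
      then show ?thesis using assms by (simp add: v_def w_def power_int_add power_int_diff)
    qed
    have R1: "R (int n + k) = (1 - q * v) * A" "R (int n - k) = (1 - q * w) * B"
      using qfact_inv_step[OF assms(2), of "int n + k + 1"]
            qfact_inv_step[OF assms(2), of "int n - k + 1"] assms
      by (simp_all add: R_def A_def B_def v_def w_def power_int_add power_int_diff mult_ac)
    have R2: "R (int n + k - 1) = (1 - v) * R (int n + k)" "R (int n - k - 1) = (1 - w) * R (int n - k)"
      using qfact_inv_step[OF assms(2), of "int n + k"] qfact_inv_step[OF assms(2), of "int n - k"]
      by (simp_all add: R_def v_def w_def)
    have b1: "binom2 (k - 1) = binom2 k + 1 - k" and b2: "binom2 (k + 1) = binom2 k + k"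
      using double_binom2[of "k - 1"] double_binom2[of k] double_binom2[of "k + 1"]
      by (simp_all add: algebra_simps)
    have u1: "q ^ n * x * u (k - 1) = - (q * w * u k)"
    proof -
      have e1: "u (k - 1) = u k * (q * inverse (q powi k) * inverse (- x))"
        using assms by (simp add: u_def b1 power_int_add power_int_diff field_simps)
      have e2: "w = q ^ n * inverse (q powi k)"
        using assms by (simp add: w_def power_int_diff field_simps)
      show ?thesis unfolding e1 e2 using assms by (simp add: field_simps)
    qed
    have u2: "q ^ n * q / x * u (k + 1) = - (q * v * u k)"
    proof -
      have e1: "u (k + 1) = u k * (q powi k * (- x))"
        unfolding u_def b2 using assms by (simp add: power_int_add field_simps)
      have e2: "v = q ^ n * q powi k"
        using assms by (simp add: v_def power_int_add)
      show ?thesis unfolding e1 e2 using assms by (simp add: field_simps)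
    qed
    have "(1 + q ^ n * (q ^ n * q)) * c k + (- (q ^ n * x)) * c (k - 1)
             + (- (q ^ n * q / x)) * c (k + 1)
        = (1 + q * (v * w)) * c k
          - (q ^ n * x * u (k - 1)) * (Q * R (int n + k - 1) * B)
          - (q ^ n * q / x * u (k + 1)) * (Q * A * R (int n - k - 1))"
      unfolding vw by (simp add: c_def A_def B_def algebra_simps)
    also have "\<dots> = u k * Q * A * B * ((1 + q * (v * w)) * (1 - q * v) * (1 - q * w)
          + q * w * (1 - v) * (1 - q * v) + q * v * (1 - w) * (1 - q * w))"
      unfolding u1 u2 R2 R1 c_def by (simp add: algebra_simps)
    also have "\<dots> = u k * Q * A * B * ((1 - q * (v * w)) * (1 - q * q * (v * w)))"
      by algebra
    also have "\<dots> = u k * ((Q * (1 - q * (v * w)) * (1 - q * q * (v * w))) * A * B)"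
      by (simp only: mult_ac)
    also have "Q * (1 - q * (v * w)) * (1 - q * q * (v * w)) = (\<Prod>i<2 * Suc n. 1 - q ^ i * q)"
    proof -
      have "2 * Suc n = Suc (Suc (n + n))" by simp
      moreover have "2 * n = n + n" by simp
      ultimately show ?thesis
        by (simp only: vw Q_def prod.lessThan_Suc power_Suc power_add mult_ac)
    qed
    also have "A = R (int (Suc n) + k)"
      by (simp add: A_def algebra_simps)
    also have "B = R (int (Suc n) - k)"
      by (simp add: B_def algebra_simps)
    finally show ?thesis .
  qed
  ultimately show ?case by (simp add: u_def R_def mult.assoc)
qed

lemma qpoch_inf_converges:
  assumes "norm q < 1"
  shows "convergent_prod (\<lambda>i. 1 - q ^ i * x)"
    and "(\<lambda>n. \<Prod>i<n. 1 - q ^ i * x) \<longlonglongrightarrow> qpoch_inf x q"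
proof -
  have "summable (\<lambda>i. norm q ^ i * norm x)"
    using assms by (intro summable_mult2 summable_geometric) simp
  then have "summable (\<lambda>i. norm ((1 - q ^ i * x) - 1))"
    by (simp add: norm_mult norm_power)
  then show C: "convergent_prod (\<lambda>i. 1 - q ^ i * x)"
    by (intro abs_convergent_prod_imp_convergent_prod summable_imp_abs_convergent_prod)
  show "(\<lambda>n. \<Prod>i<n. 1 - q ^ i * x) \<longlonglongrightarrow> qpoch_inf x q"
    using convergent_prod_LIMSEQ[OF C]
    by (subst LIMSEQ_lessThan_iff_atMost) (simp add: qpoch_inf_def)
qed

text \<open>In the finite form the coefficient of the \<open>k\<close>-th term tends to
  \<open>L / L\<^sup>2 = 1 / L\<close> with \<open>L = (q;q)\<^sub>\<infinity> \<noteq> 0\<close>; multiplying by \<open>L\<close> supplies the third factor of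
  \<open>Theta\<close>.\<close>

theorem jacobi_triple_product:
  fixes q x :: complex
  assumes "q \<noteq> 0" "norm q < 1" "x \<noteq> 0"
  shows "((\<lambda>k. (- x) powi k * q powi binom2 k) has_sum Theta x q) UNIV"
proof -
  define t where "t = (\<lambda>k. (- x) powi k * q powi binom2 k)"
  define Q where "Q = (\<lambda>n. \<Prod>i<n. 1 - q ^ i * q)"
  define R where "R = (\<lambda>n. inverse (Q n))"
  define L where "L = qpoch_inf q q"
  have Q: "Q \<longlonglongrightarrow> L"
    unfolding Q_def L_def by (rule qpoch_inf_converges[OF assms(2)])
  have L: "L \<noteq> 0"
    unfolding L_def qpoch_inf_def
    by (intro prodinf_nonzero qpoch_inf_converges one_minus_power_nonzero assms)
  have R: "R \<longlonglongrightarrow> inverse L"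
    unfolding R_def by (intro tendsto_inverse Q L)
  obtain CQ where CQ: "CQ > 0" "\<And>n. norm (Q n) \<le> CQ"
    using convergent_imp_Bseq[OF convergentI[OF Q]] by (auto elim: BseqE)
  obtain CR where CR: "CR > 0" "\<And>n. norm (R n) \<le> CR"
    using convergent_imp_Bseq[OF convergentI[OF R]] by (auto elim: BseqE)
  have qi: "qfact_inv q n = (if n < 0 then 0 else R (nat n))" for n
    by (simp add: qfact_inv_def R_def Q_def)
  have norm_qi: "norm (qfact_inv q n) \<le> CR" for n
    using CR by (simp add: qi less_imp_le)
  have qi_lim: "(\<lambda>n. qfact_inv q (int n + k)) \<longlonglongrightarrow> inverse L" for k
  proof -
    have "filterlim (\<lambda>n. nat (int n + k)) sequentially sequentially"
      unfolding filterlim_at_top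
    proof
      show "\<forall>\<^sub>F n in sequentially. Z \<le> nat (int n + k)" for Z
        by (rule eventually_sequentiallyI[of "nat (int Z - k)"]) linarith
    qed
    then have "(\<lambda>n. R (nat (int n + k))) \<longlonglongrightarrow> inverse L"
      by (rule filterlim_compose[OF R])
    moreover have "\<forall>\<^sub>F n in sequentially. R (nat (int n + k)) = qfact_inv q (int n + k)"
      by (rule eventually_sequentiallyI[of "nat (- k)"]) (auto simp: qi)
    ultimately show ?thesis by (rule Lim_transform_eventually)
  qed
  define f where "f = (\<lambda>n k. t k * (Q (2 * n) * qfact_inv q (int n + k) * qfact_inv q (int n - k)))"
  have t_abs: "(\<lambda>k. norm (t k)) summable_on UNIV"
    unfolding t_def using assms by (intro abs_summable_on_theta_terms) auto
  have "(\<lambda>n. (\<Prod>i<n. 1 - q ^ i * x) * (\<Prod>i<n. 1 - q ^ i * (q / x)))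
      \<longlonglongrightarrow> infsum (\<lambda>k. t k * (L * inverse L * inverse L)) UNIV"
  proof (rule tendsto_dominated_has_sum)
    show "(f n has_sum (\<Prod>i<n. 1 - q ^ i * x) * (\<Prod>i<n. 1 - q ^ i * (q / x))) UNIV" for n
      unfolding f_def t_def Q_def by (rule finite_triple_product[OF assms])
    show "(\<lambda>n. f n k) \<longlonglongrightarrow> t k * (L * inverse L * inverse L)" for k
    proof -
      have "(\<lambda>n. Q (2 * n)) \<longlonglongrightarrow> L"
        by (rule filterlim_compose[OF Q]) (rule filterlim_subseq, simp add: strict_mono_def)
      then show ?thesis
        unfolding f_def using qi_lim[of k] qi_lim[of "- k"] by (intro tendsto_intros) simp_all
    qed
    show "norm (f n k) \<le> norm (t k) * (CQ * CR * CR)" for n k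
      unfolding f_def norm_mult using CQ CR norm_qi by (intro mult_mono mult_nonneg_nonneg) (auto simp: less_imp_le)
    show "(\<lambda>k. norm (t k) * (CQ * CR * CR)) summable_on UNIV"
      by (rule summable_on_cmult_left[OF t_abs])
  qed
  moreover have "(\<lambda>n. (\<Prod>i<n. 1 - q ^ i * x) * (\<Prod>i<n. 1 - q ^ i * (q / x)))
      \<longlonglongrightarrow> qpoch_inf x q * qpoch_inf (q / x) q"
    by (intro tendsto_mult qpoch_inf_converges assms)
  ultimately have "qpoch_inf x q * qpoch_inf (q / x) q = infsum (\<lambda>k. t k * (L * inverse L * inverse L)) UNIV"
    by (rule LIMSEQ_unique[THEN sym])
  also have "\<dots> = infsum t UNIV * inverse L"
    using L by (simp add: infsum_cmult_left')
  finally have "infsum t UNIV = Theta x q"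
    using L by (simp add: Theta_def L_def field_simps)
  then show ?thesis
    using has_sum_infsum[OF abs_summable_summable[OF t_abs]] by (simp add: t_def)
qed

section \<open>The double series weighted by the sign of one index\<close>

text \<open>The mixed terms in \<open>n k\<close> are \<open>- a b\<close> from \<open>a binom2 r\<close> and \<open>a b\<close> from \<open>b r s\<close>,
  and cancel. What depends on \<open>k\<close> alone has leading coefficient
  \<open>(a b\<^sup>2 - 2 a b\<^sup>2 + c a\<^sup>2) / 2 = - a D / 2\<close>.\<close>

lemma exponent_shear:
  fixes a b c D t k n :: int
  assumes "D = b^2 - a * c"
  shows "a * binom2 (n - b * k) + b * (n - b * k) * (t + a * k) + c * binom2 (t + a * k)
    = c * binom2 t + (a * binom2 n + b * t * n)
      + ((a * binom2 (b + 1) - c * binom2 (a + 1) - t * D) * k + (- a * D * binom2 (k + 1)))"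
    (is "?L = ?R")
proof -
  have "2 * ?L = a * (2 * binom2 (n - b * k)) + 2 * b * (n - b * k) * (t + a * k)
                 + c * (2 * binom2 (t + a * k))" by algebra
  also have "\<dots> = c * (2 * binom2 t) + (a * (2 * binom2 n) + 2 * b * t * n)
      + ((a * (2 * binom2 (b + 1)) - c * (2 * binom2 (a + 1)) - 2 * t * D) * k
         + (- a * D * (2 * binom2 (k + 1))))"
    unfolding double_binom2 assms by algebra
  also have "\<dots> = 2 * ?R" by algebra
  finally show ?thesis by simp
qed

lemma sg_add_mult:
  assumes "0 \<le> t" "t < a"
  shows "sg (t + a * k) = sg k"
proof (cases "k \<ge> 0")
  case True
  then show ?thesis using assms by (simp add: sg_def)
next
  case False
  (* now s = t + a k is at most (a - 1) - a, so it is negative *)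
  then have "a * k \<le> a * (- 1)" using assms by (intro mult_left_mono) auto
  then show ?thesis using False assms by (simp add: sg_def)
qed

text \<open>Division with remainder of \<open>s\<close> by \<open>a\<close> recovers \<open>t\<close> and \<open>k\<close>, after which \<open>n\<close> is
  determined by \<open>r\<close>.\<close>

lemma bij_betw_shear:
  fixes a b :: int
  assumes "a > 0"
  shows "bij_betw (\<lambda>(t, k, n). (n - b * k, t + a * k)) ({0..a - 1} \<times> UNIV \<times> UNIV) UNIV"
proof (rule bij_betwI[where g = "\<lambda>(r, s). (s mod a, s div a, r + b * (s div a))"])
  have "t + a * k - (t + a * k) mod a = a * k \<and> (t + a * k) mod a = t \<and> (t + a * k) div a = k"
    if "0 \<le> t" "t \<le> a - 1" for t k
    using that assms by simp
  then show "(case (case p of (t, k, n) \<Rightarrow> (n - b * k, t + a * k)) of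
      (r, s) \<Rightarrow> (s mod a, s div a, r + b * (s div a))) = p"
    if "p \<in> {0..a - 1} \<times> UNIV \<times> UNIV" for p
    using that by auto
qed (use assms in auto)

text \<open>After the substitution the summand is \<open>C t * V t k * U t n\<close>. Absolute convergence
  permits summing over \<open>n\<close> first, where \<open>U t\<close> yields the theta function to the base \<open>q\<^sup>a\<close>, then
  over \<open>k\<close> and \<open>t\<close>.\<close>

lemma infsum_sg_second:
  fixes q x y :: complex and a b c D :: int
  assumes "q \<noteq> 0" "norm q < 1" "x \<noteq> 0" "y \<noteq> 0" "a > 0" "c > 0"
    and D: "D = b^2 - a * c" "D < 0"
  defines "F \<equiv> (\<lambda>(r, s). of_int (sg s) * ((- x) powi r * (- y) powi s
                   * q powi (a * binom2 r + b * r * s + c * binom2 s)))"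
  shows "F summable_on UNIV"
    and "infsum F UNIV =
      (\<Sum>t = 0..a - 1. (- y) powi t * q powi (c * binom2 t) * Theta (q powi (b * t) * x) (q powi a)
         * (\<Sum>\<^sub>\<infinity>r\<in>UNIV. of_int (sg r)
             * (q powi (a * binom2 (b + 1) - c * binom2 (a + 1) - t * D)
                 * ((- y) powi a / (- x) powi b)) powi r
             * q powi (- a * D * binom2 (r + 1))))"
proof -
  have sg_norm: "norm (of_int (sg s) :: complex) = 1" for s by (simp add: sg_def)
  have "(\<lambda>p. norm (F p)) = (\<lambda>(r, s). norm ((- x) powi r * (- y) powi s
                   * q powi (a * binom2 r + b * r * s + c * binom2 s)))"
    by (auto simp: F_def norm_mult sg_norm simp del: norm_of_int)
  then have "(\<lambda>p. norm (F p)) summable_on UNIV"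
    using abs_summable_on_double_theta_terms[of q "- x" "- y" a c b] assms by simp
  then show F: "F summable_on UNIV" by (rule abs_summable_summable)
  define \<phi> where "\<phi> = (\<lambda>(t, k, n). (n - b * k, t + a * k))"
  have \<phi>: "bij_betw \<phi> ({0..a - 1} \<times> UNIV \<times> UNIV) UNIV"
    unfolding \<phi>_def using assms by (intro bij_betw_shear)
  have F\<phi>: "(\<lambda>p. F (\<phi> p)) summable_on {0..a - 1} \<times> UNIV \<times> UNIV"
    using F summable_on_reindex_bij_betw[OF \<phi>, of F] by simp
  define U where "U = (\<lambda>t n. (- (q powi (b * t) * x)) powi n * (q powi a) powi binom2 n)"
  define V where "V = (\<lambda>t k. of_int (sg k)
             * (q powi (a * binom2 (b + 1) - c * binom2 (a + 1) - t * D)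
                 * ((- y) powi a / (- x) powi b)) powi k
             * q powi (- a * D * binom2 (k + 1)))"
  define C where "C = (\<lambda>t. (- y) powi t * q powi (c * binom2 t))"
  have factor: "F (\<phi> (t, k, n)) = C t * V t k * U t n" if "t \<in> {0..a - 1}" for t k n
  proof -
    have pull: "- (q powi (b * t) * x) = q powi (b * t) * (- x)" by simp
    have U: "U t n = (- x) powi n * q powi (a * binom2 n + b * t * n)"
      unfolding U_def pull power_int_mult_distrib power_int_mult[symmetric]
        power_int_add[OF disjI1[OF assms(1)]]
      by (simp only: mult_ac)
    have V: "V t k = of_int (sg k) * ((- y) powi (a * k) / (- x) powi (b * k))
        * q powi ((a * binom2 (b + 1) - c * binom2 (a + 1) - t * D) * k + (- a * D * binom2 (k + 1)))"
      unfolding V_def power_int_mult_distrib power_int_divide_distrib power_int_mult[symmetric]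
        power_int_add[OF disjI1[OF assms(1)]]
      by (simp only: mult_ac)
    have xy: "(- x) powi (n - b * k) = (- x) powi n / (- x) powi (b * k)"
             "(- y) powi (t + a * k) = (- y) powi t * (- y) powi (a * k)"
      using assms by (simp_all add: power_int_add power_int_diff)
    have q: "q powi (a * binom2 (n - b * k) + b * (n - b * k) * (t + a * k) + c * binom2 (t + a * k))
       = q powi (c * binom2 t) * q powi (a * binom2 n + b * t * n)
         * q powi ((a * binom2 (b + 1) - c * binom2 (a + 1) - t * D) * k + (- a * D * binom2 (k + 1)))"
      unfolding exponent_shear[OF D(1)] power_int_add[OF disjI1[OF assms(1)]] by (simp only: mult_ac)
    have "sg (t + a * k) = sg k" using that by (intro sg_add_mult) auto
    then show ?thesis
      unfolding F_def \<phi>_def prod.case q xy U V C_def by simp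
  qed
  have qa: "q powi a \<noteq> 0" using assms by simp
  obtain m where "a = int (Suc m)" using \<open>a > 0\<close> by (metis zero_less_imp_eq_int Suc_pred)
  then have norm_qa: "norm (q powi a) < 1"
    using norm_power_Suc_less_one[OF \<open>norm q < 1\<close>, of m] by (simp only: power_int_of_nat)
  have U: "infsum (U t) UNIV = Theta (q powi (b * t) * x) (q powi a)" for t
    unfolding U_def using assms
    by (intro infsumI jacobi_triple_product norm_qa qa) simp
  have "infsum F UNIV = infsum (\<lambda>p. F (\<phi> p)) ({0..a - 1} \<times> UNIV \<times> UNIV)"
    by (rule infsum_reindex_bij_betw[OF \<phi>, symmetric])
  also have "\<dots> = (\<Sum>t = 0..a - 1. \<Sum>\<^sub>\<infinity>p. F (\<phi> (t, p)))"
    using infsum_Sigma_banach[OF F\<phi>] by simp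
  also have "\<dots> = (\<Sum>t = 0..a - 1. C t * Theta (q powi (b * t) * x) (q powi a) * infsum (V t) UNIV)"
  proof (rule sum.cong[OF refl])
    fix t assume t: "t \<in> {0..a - 1}"
    have "(\<lambda>p. F (\<phi> (t, p))) summable_on UNIV \<times> UNIV"
    proof (rule summable_on_SigmaD1[of "\<lambda>t p. F (\<phi> (t, p))" "{0..a - 1}"])
      have "(\<lambda>(t, p). F (\<phi> (t, p))) = (\<lambda>p. F (\<phi> p))"
        by (rule ext) (simp split: prod.split)
      then show "(\<lambda>(t, p). F (\<phi> (t, p))) summable_on {0..a - 1} \<times> UNIV \<times> UNIV"
        using F\<phi> by simp
    qed (fact t)
    from infsum_Sigma_banach[OF this]
    have "(\<Sum>\<^sub>\<infinity>p. F (\<phi> (t, p))) = (\<Sum>\<^sub>\<infinity>k. \<Sum>\<^sub>\<infinity>n. F (\<phi> (t, k, n)))" by simp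
    also have "\<dots> = C t * Theta (q powi (b * t) * x) (q powi a) * infsum (V t) UNIV"
      by (simp add: factor[OF t] infsum_cmult_right' infsum_cmult_left' U mult_ac)
    finally show "(\<Sum>\<^sub>\<infinity>p. F (\<phi> (t, p)))
        = C t * Theta (q powi (b * t) * x) (q powi a) * infsum (V t) UNIV" .
  qed
  finally show "infsum F UNIV =
      (\<Sum>t = 0..a - 1. (- y) powi t * q powi (c * binom2 t) * Theta (q powi (b * t) * x) (q powi a)
         * (\<Sum>\<^sub>\<infinity>r\<in>UNIV. of_int (sg r)
             * (q powi (a * binom2 (b + 1) - c * binom2 (a + 1) - t * D)
                 * ((- y) powi a / (- x) powi b)) powi r
             * q powi (- a * D * binom2 (r + 1))))"
    by (simp add: C_def V_def)
qed

section \<open>The Hecke-type double sum\<close>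

theorem theorem1p4:
  fixes q x y :: complex and a b c D :: int
  assumes "q \<noteq> 0" and "norm q < 1"
    and "a > 0" and "b > 0" and "c > 0"
    and "D = b^2 - a * c" and "D < 0"
    and "x \<noteq> 0" and "y \<noteq> 0"
  shows "hecke_f a b c x y q =
    1 / 2 *
     ((\<Sum>t = 0..a - 1. (- y) powi t * q powi (c * binom2 t) * Theta (q powi (b * t) * x) (q powi a)
         * (\<Sum>\<^sub>\<infinity>r\<in>UNIV. of_int (sg r)
             * (q powi (a * binom2 (b + 1) - c * binom2 (a + 1) - t * D)
                 * ((- y) powi a / (- x) powi b)) powi r
             * q powi (- a * D * binom2 (r + 1))))
    + (\<Sum>t = 0..c - 1. (- x) powi t * q powi (a * binom2 t) * Theta (q powi (b * t) * y) (q powi c)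
         * (\<Sum>\<^sub>\<infinity>r\<in>UNIV. of_int (sg r)
             * (q powi (c * binom2 (b + 1) - a * binom2 (c + 1) - t * D)
                 * ((- x) powi c / (- y) powi b)) powi r
             * q powi (- c * D * binom2 (r + 1)))))"
    (is "_ = 1 / 2 * (?A + ?B)")
proof -
  define F where "F = (\<lambda>(r, s). of_int (sg s) * ((- x) powi r * (- y) powi s
                   * q powi (a * binom2 r + b * r * s + c * binom2 s)))"
  (* G is F with the roles of (a, x, r) and (c, y, s) exchanged; its pairs are listed as (s, r) *)
  define G where "G = (\<lambda>(s, r). of_int (sg r) * ((- y) powi s * (- x) powi r
                   * q powi (c * binom2 s + b * s * r + a * binom2 r)))"
  have D': "D = b^2 - c * a" using assms by (simp add: mult.commute)
  have F: "F summable_on UNIV" "infsum F UNIV = ?A"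
    unfolding F_def by (rule infsum_sg_second; fact)+
  have G: "G summable_on UNIV" "infsum G UNIV = ?B"
    unfolding G_def by (rule infsum_sg_second; fact)+
  have swap: "bij_betw prod.swap (UNIV :: (int \<times> int) set) UNIV"
    by (simp add: bij_swap)
  have G': "(\<lambda>p. G (prod.swap p)) summable_on UNIV" "(\<Sum>\<^sub>\<infinity>p. G (prod.swap p)) = ?B"
    using G summable_on_reindex_bij_betw[OF swap, of G] infsum_reindex_bij_betw[OF swap, of G]
    by simp_all
  have "hecke_f a b c x y q = (\<Sum>\<^sub>\<infinity>p. 1 / 2 * (F p + G (prod.swap p)))"
    unfolding hecke_f_def
  proof (rule infsum_cong, clarify)
    fix r s :: int
    have m: "(- z) powi k = (- 1) powi k * z powi k" for z :: complex and k
      by (metis mult_minus1 power_int_mult_distrib)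
    show "sg2 r s * (- 1) powi (r + s) * x powi r * y powi s
        * q powi (a * binom2 r + b * r * s + c * binom2 s) = 1 / 2 * (F (r, s) + G (prod.swap (r, s)))"
      unfolding F_def G_def sg2_def m[of x] m[of y]
      by (simp add: power_int_add field_simps)
  qed
  also have "\<dots> = 1 / 2 * (infsum F UNIV + (\<Sum>\<^sub>\<infinity>p. G (prod.swap p)))"
    using F(1) G'(1) by (simp only: infsum_cmult_right' infsum_add)
  finally show ?thesis unfolding F(2) G'(2) .
qed

end
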